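(* Let $A=\begin{pmatrix}a&c\\ b&d\end{pmatrix}\in SL(2,\mathbb{Z})$ have positive entries, trace $t=a+d>2$, and eigenvalues $u>1/u$. Define $p_m,q_m$ by $$A^n=\begin{pmatrix}p_{2n-1}&p_{2n-2}\\ q_{2n-1}&q_{2n-2}\end{pmatrix},\qquad\text{where } A^0=\begin{pmatrix}p_{-1}&p_{-2}\\ q_{-1}&q_{-2}\end{pmatrix}=\begin{pmatrix}1&0\\0&1\end{pmatrix}.$$ Then $A^n=tA^{n-1}-A^{n-2}$, and $$\sum_{n=2}^{\infty}\mathcal{L}\left(\left(\frac{b}{q_{2n-1}}\right)^2\right)=\mathcal{L}(1/u^2),$$ $$2\sum_{n=2}^{\infty}\mathcal{L}\left(\left(\frac{b}{q_{2n-1}}\right)^2\right)+\sum_{n=1}^{\infty}\mathcal{L}\left(\frac{bc}{q_{2n}q_{2n-4}}\right)+\sum_{n=1}^{\infty}\mathcal{L}\left(\frac{bc}{p_{2n+1}p_{2n-3}}\right)+\mathcal{L}\left(\frac{bc}{ad}\right)=\frac{\pi^2}{3}.$$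
   Context: The Rogers dilogarithm is the function on $[0,1]$ given by $\mathcal{L}(z)=\mathrm{Li}_2(z)+\frac12\log|z|\log(1-z)$, where $\mathrm{Li}_2(z)=\sum_{n\ge1}z^n/n^2$, with $\mathcal{L}(0)=0$ and $\mathcal{L}(1)=\pi^2/6$. *)

theory Defs
  imports Complex_Main "Jordan_Normal_Form.Spectral_Radius"
begin

definition Li2 :: "real \<Rightarrow> real" where
  "Li2 z = (\<Sum>n. z ^ Suc n / (real (Suc n))\<^sup>2)"

text \<open>Only the values on the closed unit interval are meaningful; outside it the value is
  an artefact of totality.\<close>

definition rogers_dilog :: "real \<Rightarrow> real" where
  "rogers_dilog z =
     (if z = 0 then 0
      else if z = 1 then pi\<^sup>2 / 6
      else Li2 z + 1 / 2 * ln \<bar>z\<bar> * ln (1 - z))"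

end

theory Submission
  imports Defs "HOL-Real_Asymp.Real_Asymp" "HOL-Analysis.Gamma_Function"
begin

text \<open>Put \<open>v = u^2\<close>. The five-term relation makes each series telescope. The entries of the
  \<open>n\<close>-th power are \<open>q\<^bsub>2n-1\<^esub> = b (u^n - u^-n) / (u - 1/u)\<close>, \<open>q\<^bsub>2n-2\<^esub> = \<alpha> u^n + \<beta> u^-n\<close> and
  \<open>p\<^bsub>2n-1\<^esub> = \<beta> u^n + \<alpha> u^-n\<close> with \<open>\<alpha> + \<beta> = 1\<close> and \<open>\<alpha> \<beta> (u - 1/u)^2 = bc\<close>, so the last two
  sequences are one sequence \<open>D\<^sub>n\<close> read for \<open>n > 0\<close> and for \<open>n < 0\<close>. The last two series and the
  term \<open>bc/(ad)\<close> then combine to the sum of \<open>L (bc / (D\<^bsub>n+1\<^esub> D\<^bsub>n-1\<^esub>))\<close> over all integers \<open>n\<close>, which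
  telescopes to \<open>2 L (1 - 1/v)\<close>; Euler's reflection formula finishes the proof.\<close>

section \<open>The Rogers dilogarithm\<close>

lemma summable_inverse_squares_Suc: "summable (\<lambda>n. 1 / (real (Suc n))\<^sup>2)"
  using inverse_squares_sums by (simp add: sums_iff add.commute)

lemma Li2_0 [simp]: "Li2 0 = 0"
  by (simp add: Li2_def)

lemma Li2_1: "Li2 1 = pi\<^sup>2 / 6"
  using inverse_squares_sums by (simp add: Li2_def sums_iff add.commute)

text \<open>Inverse squares dominate the terms on all of [0,1], so the M-test gives uniform
  convergence up to the endpoint 1, which lies on the circle of convergence.\<close>

lemma continuous_on_Li2: "continuous_on {0..1} Li2"
proof -
  have "uniform_limit {0..1} (\<lambda>n x. \<Sum>i<n. x ^ Suc i / (real (Suc i))\<^sup>2)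
          (\<lambda>x. \<Sum>i. x ^ Suc i / (real (Suc i))\<^sup>2) sequentially"
  proof (rule Weierstrass_m_test[OF _ summable_inverse_squares_Suc])
    fix n and x :: real assume "x \<in> {0..1}"
    then show "norm (x ^ Suc n / (real (Suc n))\<^sup>2) \<le> 1 / (real (Suc n))\<^sup>2"
      using power_le_one[of x "Suc n"] by (simp add: divide_right_mono del: power_Suc)
  qed
  then have "continuous_on {0..1} (\<lambda>x. \<Sum>i. x ^ Suc i / (real (Suc i))\<^sup>2)"
    by (rule uniform_limit_theorem[rotated]) (auto intro!: always_eventually continuous_intros)
  then show ?thesis by (simp add: Li2_def[abs_def])
qed

text \<open>Termwise differentiation inside the unit disc cancels one factor \<open>Suc n\<close>
  and leaves the logarithm series divided by \<open>x\<close>.\<close>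

lemma Li2_has_real_derivative:
  assumes "0 < x" "x < 1"
  shows "(Li2 has_real_derivative - ln (1 - x) / x) (at x)"
proof -
  have geom: "summable (\<lambda>n. 1 / (real (Suc n))\<^sup>2 * real (Suc n) * y ^ n)"
    if "y \<in> {-1<..<1}" for y :: real
  proof (rule summable_comparison_test[OF _ summable_geometric[of "\<bar>y\<bar>"]])
    have "norm (1 / (real (Suc n))\<^sup>2 * real (Suc n) * y ^ n) \<le> \<bar>y\<bar> ^ n" for n
    proof -
      have "norm (1 / (real (Suc n))\<^sup>2 * real (Suc n) * y ^ n) = \<bar>y\<bar> ^ n / real (Suc n)"
        by (simp add: abs_mult power_abs power2_eq_square)
      also have "\<dots> \<le> \<bar>y\<bar> ^ n"
        by (simp add: divide_le_eq mult_le_cancel_left1)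
      finally show ?thesis .
    qed
    then show "\<exists>N. \<forall>n\<ge>N. norm (1 / (real (Suc n))\<^sup>2 * real (Suc n) * y ^ n) \<le> \<bar>y\<bar> ^ n"
      by blast
  qed (use that in auto)
  have "((\<lambda>x. \<Sum>n. 1 / (real (Suc n))\<^sup>2 * x ^ Suc n) has_real_derivative
          (\<Sum>n. 1 / (real (Suc n))\<^sup>2 * real (Suc n) * x ^ n)) (at x)"
    by (rule DERIV_power_series'[where R = 1], rule geom) (use assms in auto)
  moreover have "(\<Sum>n. 1 / (real (Suc n))\<^sup>2 * real (Suc n) * x ^ n) = - ln (1 - x) / x"
  proof -
    \<comment> \<open>\<open>ln_series\<close> expands around 1, so at the point
      \<open>1 - x\<close> the base of the powers appears as \<open>1 - x - 1\<close>, that is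
      \<open>- x\<close>.\<close>
    have "ln (1 - x) = (\<Sum>n. (-1) ^ n * (1 / real (n + 1)) * (1 - x - 1) ^ Suc n)"
      by (rule ln_series) (use assms in auto)
    also have "(\<lambda>n. (-1) ^ n * (1 / real (n + 1)) * (1 - x - 1) ^ Suc n)
        = (\<lambda>n. - x * (1 / (real (Suc n))\<^sup>2 * real (Suc n) * x ^ n))"
    proof
      fix n
      have "(-1) ^ n * (- x) ^ n = x ^ n"
        by (simp flip: power_mult_distrib)
      then have "(-1) ^ n * (1 - x - 1) ^ Suc n = - x * x ^ n"
        by (simp add: mult.left_commute)
      then show "(-1) ^ n * (1 / real (n + 1)) * (1 - x - 1) ^ Suc n
          = - x * (1 / (real (Suc n))\<^sup>2 * real (Suc n) * x ^ n)"
        by (simp add: power2_eq_square)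
    qed
    also have "suminf \<dots> = - x * (\<Sum>n. 1 / (real (Suc n))\<^sup>2 * real (Suc n) * x ^ n)"
      by (rule suminf_mult[OF geom]) (use assms in auto)
    finally show ?thesis using assms by (simp add: field_simps)
  qed
  ultimately show ?thesis by (simp add: Li2_def[abs_def])
qed

section \<open>Continuity and derivative of the Rogers dilogarithm\<close>

text \<open>At 0 and at 1 one of the two logarithms is \<open>ln 1 = 0\<close>, so the product
  vanishes whatever value \<open>ln 0\<close> has, and one formula covers the closed
  interval.\<close>

lemma rogers_dilog_eq:
  assumes "0 \<le> x" "x \<le> 1"
  shows "rogers_dilog x = Li2 x + 1 / 2 * (ln x * ln (1 - x))"
  using assms by (auto simp: rogers_dilog_def Li2_1)

lemma rogers_dilog_0 [simp]: "rogers_dilog 0 = 0"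
  by (simp add: rogers_dilog_def)

lemma rogers_dilog_1: "rogers_dilog 1 = pi\<^sup>2 / 6"
  by (simp add: rogers_dilog_def)

lemma continuous_on_rogers_dilog: "continuous_on {0..1} rogers_dilog"
proof -
  have "continuous_on {0..1} (\<lambda>x::real. ln x * ln (1 - x))"
  proof (rule continuous_on_IccI)
    \<comment> \<open>At either end one factor has a linear zero, which beats the logarithmic growth
      of the other; the limit is 0, the value of the product there.\<close>
    show "((\<lambda>x::real. ln x * ln (1 - x)) \<longlongrightarrow> ln 0 * ln (1 - 0)) (at_right 0)"
      by simp real_asymp
    show "((\<lambda>x::real. ln x * ln (1 - x)) \<longlongrightarrow> ln 1 * ln (1 - 1)) (at_left 1)"
      by simp real_asymp
    show "((\<lambda>x::real. ln x * ln (1 - x)) \<longlongrightarrow> ln x * ln (1 - x)) (at x)"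
      if "0 < x" "x < 1" for x :: real
      using that by (intro tendsto_intros) auto
  qed auto
  then have "continuous_on {0..1} (\<lambda>x. Li2 x + 1 / 2 * (ln x * ln (1 - x)))"
    by (intro continuous_on_add continuous_on_mult_left continuous_on_Li2)
  then show ?thesis
    by (rule continuous_on_eq) (simp add: rogers_dilog_eq)
qed

lemma rogers_dilog_has_real_derivative:
  assumes "0 < x" "x < 1"
  shows "(rogers_dilog has_real_derivative - (ln (1 - x) / x + ln x / (1 - x)) / 2) (at x)"
proof -
  have "((\<lambda>x. Li2 x + 1 / 2 * (ln x * ln (1 - x))) has_real_derivative
          - (ln (1 - x) / x + ln x / (1 - x)) / 2) (at x)"
    using assms
    by (auto intro!: derivative_eq_intros Li2_has_real_derivative simp: field_simps)
  then show ?thesis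
    by (rule DERIV_cong_ev[THEN iffD1, rotated 3])
       (use assms in \<open>auto simp: eventually_nhds rogers_dilog_eq
          intro!: exI[of _ "{0<..<1}"]\<close>)
qed

section \<open>Reflection formula and five-term relation\<close>

text \<open>The derivative changes sign under the exchange of \<open>x\<close> and
  \<open>1 - x\<close>, so the sum is constant; its value at 0 is that of
  \<open>rogers_dilog 1\<close>.\<close>

lemma rogers_dilog_reflection:
  assumes "0 \<le> x" "x \<le> 1"
  shows "rogers_dilog x + rogers_dilog (1 - x) = pi\<^sup>2 / 6"
proof -
  let ?F = "\<lambda>x. rogers_dilog x + rogers_dilog (1 - x)"
  have "?F x = ?F 0"
  proof (cases "x = 0")
    case False
    show ?thesis
    proof (rule DERIV_isconst2[of 0 1])
      show "continuous_on {0..1} ?F"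
        by (intro continuous_intros continuous_on_rogers_dilog
              continuous_on_compose2[OF continuous_on_rogers_dilog]) auto
      show "(?F has_real_derivative 0) (at x)" if "0 < x" "x < 1" for x
      proof -
        have "((\<lambda>x. rogers_dilog (1 - x)) has_real_derivative
            - (ln (1 - (1 - x)) / (1 - x) + ln (1 - x) / (1 - (1 - x))) / 2 * (-1)) (at x)"
          using that by (intro DERIV_chain2[OF rogers_dilog_has_real_derivative])
            (auto intro!: derivative_eq_intros)
        from DERIV_add[OF rogers_dilog_has_real_derivative[OF that] this] show ?thesis
          by (simp add: add.commute)
      qed
    qed (use assms in auto)
  qed simp
  then show ?thesis by (simp add: rogers_dilog_1)
qed

text \<open>With \<open>y\<close> fixed, the difference of the two sides has zero derivative in
  \<open>x\<close> and is continuous on [0,1]; at \<open>x = 0\<close> both sides reduce to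
  \<open>rogers_dilog y\<close>.\<close>

lemma rogers_dilog_five_term:
  assumes "0 < x" "x < 1" "0 < y" "y < 1"
  shows "rogers_dilog x + rogers_dilog y = rogers_dilog (x * y)
    + rogers_dilog (x * (1 - y) / (1 - x * y)) + rogers_dilog (y * (1 - x) / (1 - x * y))"
proof -
  let ?F = "\<lambda>x. rogers_dilog x + rogers_dilog y - rogers_dilog (x * y)
    - rogers_dilog (x * (1 - y) / (1 - x * y)) - rogers_dilog (y * (1 - x) / (1 - x * y))"
  have xy: "x * y < 1" if "x \<le> 1" for x
    using mult_right_mono[of x 1 y] that assms by linarith
  have bd1: "x * (1 - y) / (1 - x * y) \<le> 1" if "x \<le> 1" for x
    using xy[OF that] that by (simp add: field_simps)
  have bd2: "y * (1 - x) / (1 - x * y) \<le> 1" if "x \<le> 1" for x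
    using xy[OF that] that assms by (simp add: field_simps)
  have "?F x = ?F 0"
  proof (rule DERIV_isconst2[of 0 1])
    show "continuous_on {0..1} ?F"
      using assms xy bd1 bd2
      by (intro continuous_intros continuous_on_rogers_dilog
            continuous_on_compose2[OF continuous_on_rogers_dilog])
         (auto simp: less_imp_le less_imp_neq intro!: divide_nonneg_pos)
    show "(?F has_real_derivative 0) (at x)" if "0 < x" "x < 1" for x
    proof -
      define w where "w = 1 - x * y"
      define A where "A = x * (1 - y) / w"
      define B where "B = y * (1 - x) / w"
      have w: "w > 0" using xy[of x] that by (simp add: w_def)
      \<comment> \<open>These factorisations make every logarithm in the derivative an integer
        combination of five: those of \<open>x\<close>, \<open>1 - x\<close>, \<open>y\<close>,
        \<open>1 - y\<close> and \<open>w\<close>.\<close>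
      have A1: "1 - A = (1 - x) / w" and B1: "1 - B = (1 - y) / w"
        using w by (simp_all add: A_def B_def field_simps) (simp_all add: w_def algebra_simps)
      have AB: "0 < A" "A < 1" "0 < B" "B < 1"
      proof -
        show "0 < A" "0 < B" using assms that w by (simp_all add: A_def B_def)
        have "0 < 1 - A" "0 < 1 - B" unfolding A1 B1 using assms that w by simp_all
        then show "A < 1" "B < 1" by simp_all
      qed
      have lnA: "ln A = ln x + ln (1 - y) - ln w" "ln (1 - A) = ln (1 - x) - ln w"
        and lnB: "ln B = ln y + ln (1 - x) - ln w" "ln (1 - B) = ln (1 - y) - ln w"
        unfolding A1 B1 unfolding A_def B_def using assms that w
        by (simp_all add: ln_mult ln_div)
      have dA: "((\<lambda>x. x * (1 - y) / (1 - x * y)) has_real_derivative (1 - y) / w\<^sup>2) (at x)"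
        using w unfolding w_def
        by (auto intro!: derivative_eq_intros simp: power2_eq_square)
           (simp add: field_simps)
      have dB: "((\<lambda>x. y * (1 - x) / (1 - x * y)) has_real_derivative - y * (1 - y) / w\<^sup>2) (at x)"
        using w unfolding w_def
        by (auto intro!: derivative_eq_intros simp: power2_eq_square)
           (simp add: divide_simps, simp add: algebra_simps)
      define l where "l = (\<lambda>x. - (ln (1 - x) / x + ln x / (1 - x)) / (2::real))"
      have L: "((\<lambda>x. rogers_dilog (g x)) has_real_derivative l (g x) * D) (at x)"
        if "0 < g x" "g x < 1" "(g has_real_derivative D) (at x)" for g D
        unfolding l_def
        by (rule DERIV_chain2[OF rogers_dilog_has_real_derivative]) (use that in auto)
      have "(?F has_real_derivative (l x * 1 + 0 - l (x * y) * y
          - l A * ((1 - y) / w\<^sup>2) - l B * (- y * (1 - y) / w\<^sup>2))) (at x)"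
        unfolding A_def B_def w_def
        using AB assms that w dA dB unfolding A_def B_def w_def
        by (intro DERIV_diff DERIV_add L DERIV_const)
           (auto intro!: derivative_eq_intros)
      moreover have "l x * 1 + 0 - l (x * y) * y
          - l A * ((1 - y) / w\<^sup>2) - l B * (- y * (1 - y) / w\<^sup>2) = 0"
      proof -
        have lxy: "l (x * y) = - (ln w / (x * y) + (ln x + ln y) / w) / 2"
          using assms that by (simp add: l_def ln_mult w_def)
        have lA: "l A = - ((ln (1 - x) - ln w) / (x * (1 - y) / w)
             + (ln x + ln (1 - y) - ln w) / ((1 - x) / w)) / 2"
          unfolding l_def lnA unfolding A1 by (simp add: A_def)
        have lB: "l B = - ((ln (1 - y) - ln w) / (y * (1 - x) / w)
             + (ln y + ln (1 - x) - ln w) / ((1 - y) / w)) / 2"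
          unfolding l_def lnB unfolding B1 by (simp add: B_def)
        define X X' Y Y' W where "X = ln x" and "X' = ln (1 - x)" and "Y = ln y"
          and "Y' = ln (1 - y)" and "W = ln w"
        have nz: "x \<noteq> 0" "1 - x \<noteq> 0" "y \<noteq> 0" "1 - y \<noteq> 0" "w \<noteq> 0"
          using assms that w by auto
        have e1: "l A * ((1 - y) / w\<^sup>2)
            = - ((X' - W) / (x * w) + (X + Y' - W) * ((1 - y) / (w * (1 - x)))) / 2"
          unfolding lA X_def[symmetric] X'_def[symmetric] Y'_def[symmetric] W_def[symmetric]
          using nz by (simp add: divide_simps power2_eq_square) (simp add: algebra_simps)
        have e2: "l B * (- y * (1 - y) / w\<^sup>2)
            = ((Y' - W) * ((1 - y) / (w * (1 - x))) + (Y + X' - W) * (y / w)) / 2"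
          unfolding lB X'_def[symmetric] Y_def[symmetric] Y'_def[symmetric] W_def[symmetric]
          using nz by (simp add: divide_simps power2_eq_square) (simp add: algebra_simps)
        have e3: "l (x * y) * y = - (W / x + (X + Y) * (y / w)) / 2"
          unfolding lxy X_def[symmetric] Y_def[symmetric] W_def[symmetric]
          using nz by (simp add: field_simps)
        have e4: "l x = - (X' / x + X * (1 / (1 - x))) / 2"
          by (simp add: l_def X_def X'_def)
        \<comment> \<open>Partial fractions: the rational coefficients are reduced to
          \<open>1 / x\<close>, \<open>m\<close> and \<open>k\<close>, after which the cancellation
          is linear in the logarithms.\<close>
        have e5: "1 / (1 - x) = y / w + (1 - y) / (w * (1 - x))"
          using nz by (simp add: divide_simps) (simp add: w_def algebra_simps)
        have e6: "(X' - W) / (x * w) = X' / x - W / x + (X' - W) * (y / w)"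
          using nz by (simp add: divide_simps) (simp add: w_def algebra_simps)
        define m k where "m = y / w" and "k = (1 - y) / (w * (1 - x))"
        show ?thesis
          unfolding mult_1_right add_0_right e1 e2 e3 e4 unfolding e5 e6
          unfolding m_def[symmetric] k_def[symmetric]
          by (simp add: algebra_simps add_divide_distrib diff_divide_distrib)
      qed
      ultimately show ?thesis by simp
    qed
  qed (use assms in auto)
  then show ?thesis by simp
qed

section \<open>Telescoping series\<close>

lemma rogers_dilog_tendsto:
  assumes "(f \<longlongrightarrow> l) F" "l \<in> {0..1}" "\<And>n. f n \<in> {0..1}"
  shows "((\<lambda>n. rogers_dilog (f n)) \<longlongrightarrow> rogers_dilog l) F"
  by (rule continuous_on_tendsto_compose[OF continuous_on_rogers_dilog])
     (use assms in \<open>auto intro: always_eventually\<close>)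

text \<open>With \<open>w = u^(2n)\<close> the argument on the left is the square of \<open>b / q\<^bsub>2n-1\<^esub>\<close>, and \<open>v * w\<close> is the
  next value of \<open>w\<close>.\<close>

lemma rogers_dilog_step:
  fixes v w :: real
  assumes "1 < v" "v < w"
  defines "f \<equiv> \<lambda>w. rogers_dilog ((v - 1) / (w - 1)) - rogers_dilog ((w - v) / (v * (w - 1)))"
  shows "rogers_dilog ((v - 1)\<^sup>2 * w / (v * (w - 1)\<^sup>2)) = f w - f (v * w)"
proof -
  \<comment> \<open>In the five-term relation for this pair, \<open>x\<close> and
    \<open>x * y\<close> are the first arguments of \<open>f\<close> at \<open>w\<close> and at
    \<open>v * w\<close>. The second arguments there are the quotient in \<open>t2\<close> and
    \<open>y\<close>, so the quotient in \<open>t1\<close> is left as the difference.\<close>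
  define x where "x = (v - 1) / (w - 1)"
  define y where "y = (w - 1) / (v * w - 1)"
  have vw: "1 < w" "w < v * w" "1 < v * w" "v * w < v * (v * w)"
    using assms by (simp_all add: less_1_mult)
  have x1: "1 - x = (w - v) / (w - 1)" and y1: "1 - y = w * (v - 1) / (v * w - 1)"
    and xy: "x * y = (v - 1) / (v * w - 1)" and xy1: "1 - x * y = v * (w - 1) / (v * w - 1)"
    using vw by (simp_all add: x_def y_def divide_simps) (simp_all add: algebra_simps)
  have t1: "x * (1 - y) / (1 - x * y) = (v - 1)\<^sup>2 * w / (v * (w - 1)\<^sup>2)"
    unfolding y1 xy1 unfolding x_def using vw assms by (simp add: divide_simps power2_eq_square)
  have t2: "y * (1 - x) / (1 - x * y) = (w - v) / (v * (w - 1))"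
    unfolding x1 xy1 unfolding y_def using vw assms by (simp add: divide_simps)
  have y2: "y = (v * w - v) / (v * (v * w - 1))"
    using vw assms by (simp add: y_def divide_simps) (simp add: algebra_simps)
  have "rogers_dilog x + rogers_dilog y = rogers_dilog (x * y)
    + rogers_dilog (x * (1 - y) / (1 - x * y)) + rogers_dilog (y * (1 - x) / (1 - x * y))"
    by (rule rogers_dilog_five_term) (use vw assms in \<open>simp_all add: x_def y_def\<close>)
  then show ?thesis
    unfolding t1 t2 unfolding xy unfolding f_def y2 x_def by simp
qed

text \<open>The sum is the initial value of \<open>f\<close>, which is 0, minus its limit, which is
  \<open>- rogers_dilog (1 / v)\<close>. The exponent \<open>k + 2\<close> makes the series start at
  \<open>n = 2\<close>.\<close>

lemma rogers_dilog_powers_sums: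
  fixes v :: real
  assumes v: "1 < v"
  shows "(\<lambda>k. rogers_dilog ((v - 1)\<^sup>2 * v ^ (k + 2) / (v * (v ^ (k + 2) - 1)\<^sup>2)))
           sums rogers_dilog (1 / v)"
proof -
  define f where
    "f = (\<lambda>w. rogers_dilog ((v - 1) / (w - 1)) - rogers_dilog ((w - v) / (v * (w - 1))))"
  have gt: "v < v ^ (k + 2)" for k
    using power_strict_increasing[of 1 "k + 2" v] v by simp
  have "(\<lambda>k. f (v ^ (k + 2))) \<longlonglongrightarrow> rogers_dilog 0 - rogers_dilog (1 / v)"
    unfolding f_def
  proof (intro tendsto_diff rogers_dilog_tendsto)
    show "(\<lambda>k. (v - 1) / (v ^ (k + 2) - 1)) \<longlonglongrightarrow> 0"
      using v by real_asymp
    have "(\<lambda>k. (v ^ (k + 2) - v) / (v * (v ^ (k + 2) - 1))) \<longlonglongrightarrow> inverse v"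
      using v by real_asymp
    then show "(\<lambda>k. (v ^ (k + 2) - v) / (v * (v ^ (k + 2) - 1))) \<longlonglongrightarrow> 1 / v"
      by (simp only: inverse_eq_divide)
    have "(v - 1) / (w - 1) \<in> {0..1}" "(w - v) / (v * (w - 1)) \<in> {0..1}" if "v < w" for w
      using that v by (simp_all add: divide_le_eq right_diff_distrib mult_le_cancel_right1)
    from this[OF gt] show "(v - 1) / (v ^ (k + 2) - 1) \<in> {0..1}"
      "(v ^ (k + 2) - v) / (v * (v ^ (k + 2) - 1)) \<in> {0..1}" for k
      by blast+
  qed (use v in auto)
  from telescope_sums'[OF this]
  have "(\<lambda>k. f (v ^ (k + 2)) - f (v * v ^ (k + 2))) sums (f (v\<^sup>2) + rogers_dilog (1 / v))"
    by (simp add: power2_eq_square)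
  moreover have "f (v ^ (k + 2)) - f (v * v ^ (k + 2))
      = rogers_dilog ((v - 1)\<^sup>2 * v ^ (k + 2) / (v * (v ^ (k + 2) - 1)\<^sup>2))" for k
    unfolding f_def by (rule rogers_dilog_step[symmetric]) (use v gt in auto)
  \<comment> \<open>At \<open>v\<^sup>2\<close> both arguments in \<open>f\<close> equal
    \<open>1 / (v + 1)\<close>.\<close>
  moreover have "f (v\<^sup>2) = 0"
  proof -
    have "(v - 1) / (v\<^sup>2 - 1) = (v\<^sup>2 - v) / (v * (v\<^sup>2 - 1))"
    proof -
      have "v\<^sup>2 - v = v * (v - 1)" by (simp add: power2_eq_square right_diff_distrib)
      then show ?thesis using v by simp
    qed
    then show ?thesis by (simp add: f_def)
  qed
  ultimately show ?thesis by (simp only: add_0_left)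
qed

section \<open>Telescoping with four potentials\<close>

text \<open>For \<open>v > 1\<close> the argument decreases from 1 - 1/v to 0 as \<open>r\<close>
  runs from 0 to infinity; these two ends supply the boundary terms of the series.\<close>

definition dilog_potential :: "real \<Rightarrow> real \<Rightarrow> real" where
  "dilog_potential v r = rogers_dilog ((v - 1) / (r + v))"

text \<open>With \<open>r = (\<alpha>/\<beta>) u^(2n)\<close> the argument on the left is \<open>bc / (D\<^bsub>n+1\<^esub> D\<^bsub>n-1\<^esub>)\<close>, and multiplying
  \<open>r\<close> by \<open>v\<close> passes from \<open>n\<close> to \<open>n + 1\<close>.\<close>

lemma rogers_dilog_four_potentials:
  fixes v r :: real
  assumes "1 < v" "0 < r"
  shows "rogers_dilog ((v - 1)\<^sup>2 * r / ((v * r + 1) * (r + v)))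
    = dilog_potential v r + dilog_potential v (1 / r)
      - dilog_potential v (v * r) - dilog_potential v (v / r)"
proof -
  \<comment> \<open>\<open>x\<close> and \<open>y\<close> are the arguments of the potential at
    \<open>r\<close> and \<open>1 / r\<close>. The two quotients of the five-term relation are its
    arguments at \<open>v * r\<close> and \<open>v / r\<close>, and the product \<open>x * y\<close>
    is the argument to be expanded.\<close>
  define x where "x = (v - 1) / (r + v)"
  define y where "y = (v - 1) / (1 / r + v)"
  have pos: "0 < v * r + 1" "0 < r + v"
    using assms by (simp_all add: add_pos_pos)
  have y: "y = (v - 1) * r / (v * r + 1)"
    using assms pos by (simp add: y_def field_simps)
  have x1: "1 - x = (r + 1) / (r + v)" and y1: "1 - y = (r + 1) / (v * r + 1)"
    and xy: "x * y = (v - 1)\<^sup>2 * r / ((v * r + 1) * (r + v))"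
    and xy1: "1 - x * y = v * (r + 1)\<^sup>2 / ((v * r + 1) * (r + v))"
    using pos by (simp_all add: x_def y divide_simps power2_eq_square)
      (simp_all add: algebra_simps)
  have pos': "0 < 1 - x" "0 < 1 - y" "0 < x" "0 < y"
    using assms pos unfolding x1 y1 by (simp_all add: x_def y)
  have t1: "x * (1 - y) / (1 - x * y) = (v - 1) / (v * r + v)"
  proof -
    have "x * (1 - y) / (1 - x * y) = (v - 1) / (v * (r + 1))"
      unfolding y1 xy1 unfolding x_def using pos assms
      by (simp add: divide_simps power2_eq_square)
    then show ?thesis by (simp add: distrib_left)
  qed
  have t2: "y * (1 - x) / (1 - x * y) = (v - 1) / (v / r + v)"
  proof -
    have "y * (1 - x) / (1 - x * y) = (v - 1) * r / (v * (r + 1))"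
      unfolding x1 xy1 unfolding y using pos assms
      by (simp add: divide_simps power2_eq_square)
    also have "\<dots> = (v - 1) / (v / r + v)"
    proof -
      have "v / r + v = v * (r + 1) / r"
        using assms by (simp add: field_simps)
      then show ?thesis by simp
    qed
    finally show ?thesis .
  qed
  have "rogers_dilog x + rogers_dilog y = rogers_dilog (x * y)
    + rogers_dilog (x * (1 - y) / (1 - x * y)) + rogers_dilog (y * (1 - x) / (1 - x * y))"
    by (rule rogers_dilog_five_term) (use pos' in auto)
  then show ?thesis
    unfolding t1 t2 unfolding xy unfolding x_def y_def dilog_potential_def by simp
qed

text \<open>Since \<open>v / r (Suc k) = 1 / r k\<close>, the four potentials regroup as
  \<open>T k - T (Suc k)\<close>. As \<open>r k\<close> grows, the first potential in
  \<open>T k\<close> tends to 0, while \<open>v / r k\<close> tends to 0 and the second one to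
  \<open>rogers_dilog (1 - 1 / v)\<close>.\<close>

lemma four_potentials_sums:
  fixes v \<rho> :: real
  assumes v: "1 < v" and \<rho>: "0 < \<rho>"
  defines "r \<equiv> \<lambda>k. \<rho> * v ^ (k + 1)"
  shows "(\<lambda>k. rogers_dilog ((v - 1)\<^sup>2 * r k / ((v * r k + 1) * (r k + v))))
    sums (dilog_potential v (\<rho> * v) - dilog_potential v (1 / \<rho>) + rogers_dilog (1 - 1 / v))"
proof -
  have rpos: "0 < r k" for k using v \<rho> by (simp add: r_def)
  define T where "T = (\<lambda>k. dilog_potential v (r k) - dilog_potential v (v / r k))"
  have bound: "(v - 1) / (x + v) \<in> {0..1}" if "0 < x" for x
    using v that by (simp add: divide_le_eq)
  have "T \<longlonglongrightarrow> rogers_dilog 0 - rogers_dilog (1 - 1 / v)"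
    unfolding T_def dilog_potential_def
  proof (intro tendsto_diff rogers_dilog_tendsto)
    show "(\<lambda>k. (v - 1) / (r k + v)) \<longlonglongrightarrow> 0"
      unfolding r_def using v \<rho> by real_asymp
    have "(\<lambda>k. (v - 1) / (v / r k + v)) \<longlonglongrightarrow> (v - 1) * inverse v"
      unfolding r_def using v \<rho> by real_asymp
    moreover have "(v - 1) * inverse v = 1 - 1 / v"
      using v by (simp add: field_simps)
    ultimately show "(\<lambda>k. (v - 1) / (v / r k + v)) \<longlonglongrightarrow> 1 - 1 / v"
      by (simp only:)
  qed (use v rpos in \<open>auto intro!: bound simp del: atLeastAtMost_iff\<close>, use v in auto)
  from telescope_sums'[OF this]
  have "(\<lambda>k. T k - T (Suc k)) sums (T 0 + rogers_dilog (1 - 1 / v))"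
    by simp
  moreover have "T k - T (Suc k)
      = rogers_dilog ((v - 1)\<^sup>2 * r k / ((v * r k + 1) * (r k + v)))" for k
  proof -
    have "r (Suc k) = v * r k" "v / r (Suc k) = 1 / r k"
      using v by (simp_all add: r_def)
    then show ?thesis
      unfolding rogers_dilog_four_potentials[OF v rpos] T_def by simp
  qed
  moreover have "T 0 = dilog_potential v (\<rho> * v) - dilog_potential v (1 / \<rho>)"
    using v by (simp add: T_def r_def)
  ultimately show ?thesis by simp
qed

text \<open>Each factor of the denominator contains \<open>\<beta> / (w * u)\<close> and the
  numerator contains its square. After cancellation only \<open>r\<close> and
  \<open>u\<^sup>2\<close> remain, as in \<open>rogers_dilog_four_potentials\<close>.\<close>

lemma bilinear_ratio_eq:
  fixes u \<alpha> \<beta> w :: real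
  assumes "0 < u" "0 < \<alpha>" "0 < \<beta>" "0 < w"
  defines "r \<equiv> \<alpha> / \<beta> * w\<^sup>2"
  shows "\<alpha> * \<beta> * (u - 1 / u)\<^sup>2
      / ((\<alpha> * (w * u) + \<beta> / (w * u)) * (\<alpha> * (w / u) + \<beta> / (w / u)))
    = (u\<^sup>2 - 1)\<^sup>2 * r / ((u\<^sup>2 * r + 1) * (r + u\<^sup>2))"
proof -
  have "\<alpha> * (w * u) + \<beta> / (w * u) = \<beta> / (w * u) * (u\<^sup>2 * r + 1)"
    and "\<alpha> * (w / u) + \<beta> / (w / u) = \<beta> / (w * u) * (r + u\<^sup>2)"
    and "\<alpha> * \<beta> * (u - 1 / u)\<^sup>2 = (\<beta> / (w * u)) * (\<beta> / (w * u)) * ((u\<^sup>2 - 1)\<^sup>2 * r)"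
    using assms by (simp_all add: field_simps power2_eq_square)
  then show ?thesis using assms by simp
qed

text \<open>The indices \<open>k\<close> and \<open>k + 2\<close> are centred at
  \<open>k + 1\<close>, whence \<open>w = u ^ (k + 1)\<close>. Exchanging \<alpha> and \<beta> turns
  the series for the lower right entries into the one for the upper left entries.\<close>

lemma bilinear_ratio_sums:
  fixes u \<alpha> \<beta> :: real
  assumes u: "1 < u" and pos: "0 < \<alpha>" "0 < \<beta>"
  shows "(\<lambda>k. rogers_dilog (\<alpha> * \<beta> * (u - 1 / u)\<^sup>2
        / ((\<alpha> * u ^ (k + 2) + \<beta> / u ^ (k + 2)) * (\<alpha> * u ^ k + \<beta> / u ^ k))))
    sums (dilog_potential (u\<^sup>2) (\<alpha> / \<beta> * u\<^sup>2) - dilog_potential (u\<^sup>2) (\<beta> / \<alpha>)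
      + rogers_dilog (1 - 1 / u\<^sup>2))"
proof -
  have "\<alpha> * \<beta> * (u - 1 / u)\<^sup>2
        / ((\<alpha> * u ^ (k + 2) + \<beta> / u ^ (k + 2)) * (\<alpha> * u ^ k + \<beta> / u ^ k))
      = (u\<^sup>2 - 1)\<^sup>2 * (\<alpha> / \<beta> * (u\<^sup>2) ^ (k + 1))
        / ((u\<^sup>2 * (\<alpha> / \<beta> * (u\<^sup>2) ^ (k + 1)) + 1) * (\<alpha> / \<beta> * (u\<^sup>2) ^ (k + 1) + u\<^sup>2))" for k
  proof -
    have "u ^ (k + 1) * u = u ^ (k + 2)" "u ^ (k + 1) / u = u ^ k"
      "(u ^ (k + 1))\<^sup>2 = (u\<^sup>2) ^ (k + 1)"
      using u by (simp, simp, simp only: power_mult[symmetric] mult.commute)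
    moreover have "0 < u" "0 < u ^ (k + 1)"
      using u by simp_all
    ultimately show ?thesis
      using bilinear_ratio_eq[of u \<alpha> \<beta> "u ^ (k + 1)"] pos by (simp only:)
  qed
  moreover have "1 < u\<^sup>2" using u by simp
  ultimately show ?thesis
    using four_potentials_sums[of "u\<^sup>2" "\<alpha> / \<beta>"] pos by simp
qed

section \<open>Powers of a unimodular matrix\<close>

abbreviation (input) mat2 :: "'a \<Rightarrow> 'a \<Rightarrow> 'a \<Rightarrow> 'a \<Rightarrow> 'a mat" where
  "mat2 x y z w \<equiv> mat_of_rows_list 2 [[x, y], [z, w]]"

lemma mat2_carrier: "mat2 x y z w \<in> carrier_mat 2 2"
  by (simp add: mat_of_rows_list_def numeral_2_eq_2)

lemma mat2_index:
  "mat2 x y z w $$ (0, 0) = x" "mat2 x y z w $$ (0, 1) = y"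
  "mat2 x y z w $$ (1, 0) = z" "mat2 x y z w $$ (1, 1) = w"
  by (simp_all add: mat_of_rows_list_def)

lemma mat2_eqI:
  assumes "M \<in> carrier_mat 2 2" "M $$ (0, 0) = x" "M $$ (0, 1) = y"
    "M $$ (1, 0) = z" "M $$ (1, 1) = w"
  shows "M = mat2 x y z w"
  using assms by (intro eq_matI) (auto simp: less_Suc_eq numeral_2_eq_2 mat_of_rows_list_def)

lemma mat2_eq_iff:
  "mat2 x y z w = mat2 x' y' z' w' \<longleftrightarrow> x = x' \<and> y = y' \<and> z = z' \<and> w = w'"
  by (metis mat2_index)

lemma mat2_mult:
  fixes x y z w :: "'a :: comm_semiring_0"
  shows "mat2 x y z w * mat2 x' y' z' w'
    = mat2 (x * x' + y * z') (x * y' + y * w') (z * x' + w * z') (z * y' + w * w')"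
  by (rule mat2_eqI)
     (auto simp: mat_of_rows_list_def scalar_prod_def numeral_2_eq_2)

lemma det_mat2:
  fixes x y z w :: "'a :: comm_ring_1"
  shows "det (mat2 x y z w) = x * w - y * z"
proof -
  \<comment> \<open>The minors are one-by-one, so the determinant of each is its only entry.\<close>
  have *: "det (mat_delete (mat2 x y z w) 0 j) = mat_delete (mat2 x y z w) 0 j $$ (0, 0)" for j
    by (rule det_single) (simp add: mat_of_rows_list_def mat_delete_def)
  have "det (mat2 x y z w) = (\<Sum>j<2. mat2 x y z w $$ (0, j) * cofactor (mat2 x y z w) 0 j)"
    by (rule laplace_expansion_row[OF mat2_carrier]) simp
  then show ?thesis
    by (simp add: numeral_2_eq_2 cofactor_def *[unfolded numeral_2_eq_2])
       (simp add: mat_delete_def mat_of_rows_list_def)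
qed

lemma eigenvalue_mat2:
  fixes x y z w e :: "'a :: field"
  shows "eigenvalue (mat2 x y z w) e \<longleftrightarrow> (x - e) * (w - e) - y * z = 0"
proof -
  have "char_matrix (mat2 x y z w) e = mat2 (x - e) y z (w - e)"
    by (rule mat2_eqI) (auto simp: char_matrix_def mat_of_rows_list_def)
  then show ?thesis
    by (simp add: eigenvalue_det[OF mat2_carrier] det_mat2)
qed

section \<open>Closed form and recurrence of the powers\<close>

text \<open>Every entry of the n-th power is a combination of \<open>u ^ n\<close> and its inverse.
  The coefficients \<alpha>, \<beta> are those matching the diagonal entries at \<open>n = 0\<close>
  and \<open>n = 1\<close>; induction on \<open>n\<close> through right multiplication does the
  rest.\<close>

lemma mat2_pow_closed_form:
  fixes a b c d :: int and P C B D :: "nat \<Rightarrow> int" and u h \<alpha> \<beta> :: real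
  assumes pow: "\<And>n. mat2 a c b d ^\<^sub>m n = mat2 (P n) (C n) (B n) (D n)"
    and det: "a * d - c * b = 1"
    and u: "1 < u" "u + 1 / u = a + d"
  defines "h \<equiv> u - 1 / u"
  defines "\<alpha> \<equiv> (d - 1 / u) / h" and "\<beta> \<equiv> (a - 1 / u) / h"
  shows "\<alpha> * \<beta> * h\<^sup>2 = b * c"
    "P n = \<beta> * u ^ n + \<alpha> / u ^ n"
    "B n = b * ((u ^ n - 1 / u ^ n) / h)" "D n = \<alpha> * u ^ n + \<beta> / u ^ n"
proof -
  have h: "0 < h" using u by (simp add: h_def field_simps less_1_mult)
  have id: "1\<^sub>m 2 = mat2 1 0 0 (1 :: int)"
    by (rule mat2_eqI) auto
  have zero: "P 0 = 1" "C 0 = 0" "B 0 = 0" "D 0 = 1"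
    using pow[of 0] mat2_carrier[of a c b d] by (auto simp: id mat2_eq_iff)
  have suc: "P (Suc n) = P n * a + C n * b" "C (Suc n) = P n * c + C n * d"
    "B (Suc n) = B n * a + D n * b" "D (Suc n) = B n * c + D n * d" for n
    using pow[of "Suc n"] by (simp_all add: pow mat2_mult mat2_eq_iff)
  define i where "i = 1 / u"
  have ui: "u * i = 1" and h_eq: "h = u - i" and tr: "u + i = a + d"
    using u by (simp_all add: i_def h_def)
  have \<alpha>: "\<alpha> * h = d - i" and \<beta>: "\<beta> * h = a - i"
    using h by (simp_all add: \<alpha>_def \<beta>_def i_def)
  have det': "real_of_int a * real_of_int d - real_of_int c * real_of_int b = 1"
    using arg_cong[OF det, of real_of_int] by simp
  \<comment> \<open>Identities between \<alpha> and \<beta> are checked after multiplication by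
    \<open>h\<close>, which clears their denominators.\<close>
  have cancel: "x = y" if "x * h = y * h" for x y :: real
    using that h by simp
  have sum: "\<alpha> + \<beta> = 1"
  proof (rule cancel)
    have "(\<alpha> + \<beta>) * h = (d - i) + (a - i)"
      by (simp only: distrib_right \<alpha> \<beta>)
    also have "\<dots> = 1 * h"
      using tr by (simp add: h_eq)
    finally show "(\<alpha> + \<beta>) * h = 1 * h" .
  qed
  have d: "real_of_int d = \<alpha> * u + \<beta> * i"
  proof (rule cancel)
    have "(\<alpha> * u + \<beta> * i) * h = (\<alpha> * h) * u + (\<beta> * h) * i"
      by (simp add: algebra_simps)
    also have "\<dots> = d * u + (a + d - (u + i)) * i - d * i"
      unfolding \<alpha> \<beta> by (simp add: algebra_simps)
    also have "\<dots> = d * h"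
      unfolding tr h_eq by (simp add: algebra_simps)
    finally show "real_of_int d * h = (\<alpha> * u + \<beta> * i) * h" ..
  qed
  have a: "real_of_int a = \<beta> * u + \<alpha> * i"
  proof -
    have "a = (u + i) - d" using tr by simp
    also have "\<dots> = (\<alpha> + \<beta>) * (u + i) - (\<alpha> * u + \<beta> * i)"
      unfolding sum d by simp
    finally show ?thesis by (simp add: algebra_simps)
  qed
  have "(\<alpha> * h) * (\<beta> * h) = b * c"
  proof -
    \<comment> \<open>This is the characteristic equation at the eigenvalue \<open>1 / u\<close>,
      obtained from the trace and \<open>u * i = 1\<close>.\<close>
    have "(d - i) * (a - i) = real_of_int a * d - i * (u + i) + i * i"
      unfolding tr by (simp add: algebra_simps)
    also have "\<dots> = b * c"
      using ui det' by (simp add: distrib_left mult_ac)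
    finally show ?thesis by (simp only: \<alpha> \<beta>)
  qed
  then show prod: "\<alpha> * \<beta> * h\<^sup>2 = b * c"
    by (simp add: power2_eq_square mult_ac)
  have coeff: "real_of_int b * c / h = \<alpha> * \<beta> * h"
  proof -
    have "real_of_int b * c = \<alpha> * \<beta> * h * h"
      using prod by (simp add: power2_eq_square mult.assoc)
    then show ?thesis using h by simp
  qed
  \<comment> \<open>\<open>C\<close> joins the induction because the recursion for \<open>P\<close>
    involves it.\<close>
  have "P n = \<beta> * u ^ n + \<alpha> * i ^ n \<and> C n = c * ((u ^ n - i ^ n) / h) \<and>
    B n = b * ((u ^ n - i ^ n) / h) \<and> D n = \<alpha> * u ^ n + \<beta> * i ^ n"
  proof (induction n)
    case 0
    then show ?case using zero sum by simp
  next
    case (Suc n)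
    define U V where "U = u ^ n" and "V = i ^ n"
    note IH = Suc[folded U_def V_def]
    have diag: "real_of_int b * c * ((U - V) / h) = \<alpha> * \<beta> * h * (U - V)"
      unfolding coeff[symmetric] by simp
    have "real_of_int (P (Suc n)) = (\<beta> * U + \<alpha> * V) * a + \<alpha> * \<beta> * h * (U - V)"
      unfolding diag[symmetric] using IH by (simp add: suc)
    also have "\<dots> = \<beta> * (U * u) + \<alpha> * (V * i)"
    proof -
      have "(\<beta> * U + \<alpha> * V) * (\<beta> * u + \<alpha> * i) + \<alpha> * \<beta> * (u - i) * (U - V)
          = (\<alpha> + \<beta>) * (\<beta> * (U * u) + \<alpha> * (V * i))"
        by (simp add: algebra_simps)
      then show ?thesis unfolding sum a h_eq by simp
    qed
    finally have 1: "real_of_int (P (Suc n)) = \<beta> * (U * u) + \<alpha> * (V * i)" .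
    have "real_of_int (D (Suc n)) = (\<alpha> * U + \<beta> * V) * d + \<alpha> * \<beta> * h * (U - V)"
      unfolding diag[symmetric] using IH by (simp add: suc)
    also have "\<dots> = \<alpha> * (U * u) + \<beta> * (V * i)"
    proof -
      have "(\<alpha> * U + \<beta> * V) * (\<alpha> * u + \<beta> * i) + \<alpha> * \<beta> * (u - i) * (U - V)
          = (\<alpha> + \<beta>) * (\<alpha> * (U * u) + \<beta> * (V * i))"
        by (simp add: algebra_simps)
      then show ?thesis unfolding sum d h_eq by simp
    qed
    finally have 2: "real_of_int (D (Suc n)) = \<alpha> * (U * u) + \<beta> * (V * i)" .
    define Q where "Q = (U - V) / h"
    have Q: "Q * h = U - V"
      using h by (simp add: Q_def)
    have a': "real_of_int a = u + i - d"
      using tr by simp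
    have "(\<beta> * U + \<alpha> * V + Q * d) * h = (\<beta> * h) * U + (\<alpha> * h) * V + (Q * h) * d"
      "(Q * a + \<alpha> * U + \<beta> * V) * h = (Q * h) * a + (\<alpha> * h) * U + (\<beta> * h) * V"
      by (simp_all add: algebra_simps)
    then have "(\<beta> * U + \<alpha> * V + Q * d) * h = U * u - V * i"
      "(Q * a + \<alpha> * U + \<beta> * V) * h = U * u - V * i"
      unfolding Q \<alpha> \<beta> a' by (simp_all add: algebra_simps)
    then have off: "\<beta> * U + \<alpha> * V + (U - V) / h * d = (U * u - V * i) / h"
      "(U - V) / h * a + \<alpha> * U + \<beta> * V = (U * u - V * i) / h"
      using h by (simp_all add: eq_divide_eq Q_def)
    have "real_of_int (C (Suc n)) = c * (\<beta> * U + \<alpha> * V + (U - V) / h * d)"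
      "real_of_int (B (Suc n)) = b * ((U - V) / h * a + \<alpha> * U + \<beta> * V)"
      using IH by (simp_all only: suc of_int_add of_int_mult distrib_left mult_ac)
    note 3 = this[unfolded off]
    show ?case using 1 2 3 by (simp add: U_def V_def mult.commute)
  qed
  then show "P n = \<beta> * u ^ n + \<alpha> / u ^ n"
    "B n = b * ((u ^ n - 1 / u ^ n) / h)" "D n = \<alpha> * u ^ n + \<beta> / u ^ n"
    by (simp_all add: i_def power_divide)
qed

text \<open>Cayley-Hamilton for determinant 1, multiplied by the m-th power.\<close>

lemma mat2_pow_recurrence:
  fixes x y z w :: "'a :: comm_ring_1"
  assumes "x * w - y * z = 1"
  shows "mat2 x y z w ^\<^sub>m (m + 2)
    = (x + w) \<cdot>\<^sub>m mat2 x y z w ^\<^sub>m (m + 1) - mat2 x y z w ^\<^sub>m m"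
proof -
  have "mat2 x y z w ^\<^sub>m m \<in> carrier_mat 2 2"
    by (intro pow_carrier_mat mat2_carrier)
  then obtain e f g h where m: "mat2 x y z w ^\<^sub>m m = mat2 e f g h"
    by (rule that[OF mat2_eqI[OF _ refl refl refl refl]])
  have lin: "t \<cdot>\<^sub>m mat2 e f g h - mat2 e' f' g' h'
      = mat2 (t * e - e') (t * f - f') (t * g - g') (t * h - h')" for t e f g h e' f' g' h' :: 'a
    by (rule mat2_eqI) (auto simp: mat_of_rows_list_def numeral_2_eq_2)
  \<comment> \<open>The coefficient 1 of the m-th power is written as the determinant, so that the
    claim becomes a polynomial identity in each entry.\<close>
  have "(x + w) \<cdot>\<^sub>m mat2 x y z w ^\<^sub>m (m + 1) - mat2 x y z w ^\<^sub>m m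
      = (x + w) \<cdot>\<^sub>m (mat2 e f g h * mat2 x y z w)
        - mat2 ((x * w - y * z) * e) ((x * w - y * z) * f) ((x * w - y * z) * g) ((x * w - y * z) * h)"
    unfolding assms by (simp add: m)
  also have "\<dots> = mat2 e f g h * mat2 x y z w * mat2 x y z w"
    unfolding mat2_mult lin mat2_eq_iff by (simp add: algebra_simps)
  also have "\<dots> = mat2 x y z w ^\<^sub>m (m + 2)"
    by (simp add: m)
  finally show ?thesis ..
qed

section \<open>Evaluation of the three series\<close>

text \<open>\<open>p\<close> and \<open>q\<close> have integer indices because the zeroth power
  involves -1 and -2. Convergence of all three series is part of the claim, since an infinite sum
  carries meaning only together with it.\<close>

theorem theorem1p5:
  fixes a b c d t :: int
    and A :: "int mat"
    and u :: real
    and p q :: "int \<Rightarrow> int"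
  assumes A_def: "A = mat_of_rows_list 2 [[a, c], [b, d]]"
    and det_A: "det A = 1"
    and pos: "a > 0" "b > 0" "c > 0" "d > 0"
    and trace_A: "t = a + d" "t > 2"
    and eigenvalues: "spectrum (map_mat real_of_int A) = {u, 1 / u}" "u > 1 / u"
    and pq: "\<And>n :: nat. A ^\<^sub>m n =
               mat_of_rows_list 2 [[p (2 * int n - 1), p (2 * int n - 2)],
                                   [q (2 * int n - 1), q (2 * int n - 2)]]"
  shows "(\<forall>n :: nat \<ge> 2. A ^\<^sub>m n = t \<cdot>\<^sub>m A ^\<^sub>m (n - 1) - A ^\<^sub>m (n - 2))
    \<and> (let
         S1 = (\<lambda>n :: int. rogers_dilog ((real_of_int b / real_of_int (q (2 * n - 1)))\<^sup>2));
         S2 = (\<lambda>n :: int. rogers_dilog (real_of_int (b * c) / real_of_int (q (2 * n) * q (2 * n - 4))));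
         S3 = (\<lambda>n :: int. rogers_dilog (real_of_int (b * c) / real_of_int (p (2 * n + 1) * p (2 * n - 3))))
       in
         (\<lambda>k :: nat. S1 (int k + 2)) sums rogers_dilog (1 / u\<^sup>2)
       \<and> summable (\<lambda>k :: nat. S2 (int k + 1))
       \<and> summable (\<lambda>k :: nat. S3 (int k + 1))
       \<and> 2 * (\<Sum>k :: nat. S1 (int k + 2)) + (\<Sum>k :: nat. S2 (int k + 1))
           + (\<Sum>k :: nat. S3 (int k + 1))
           + rogers_dilog (real_of_int (b * c) / real_of_int (a * d)) = pi\<^sup>2 / 3)"
proof -
  define P C B D where "P = (\<lambda>n :: nat. p (2 * int n - 1))" and "C = (\<lambda>n :: nat. p (2 * int n - 2))"
    and "B = (\<lambda>n :: nat. q (2 * int n - 1))" and "D = (\<lambda>n :: nat. q (2 * int n - 2))"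
  define h where "h = u - 1 / u"
  define \<alpha> where "\<alpha> = (d - 1 / u) / h"
  define \<beta> where "\<beta> = (a - 1 / u) / h"
  have pow: "mat2 a c b d ^\<^sub>m n = mat2 (P n) (C n) (B n) (D n)" for n
    using pq[of n] by (simp add: A_def P_def C_def B_def D_def)
  have det: "a * d - c * b = 1"
    using det_A by (simp add: A_def det_mat2)
  have "map_mat real_of_int A = mat2 (real_of_int a) c b d"
    unfolding A_def by (rule mat2_eqI) (simp_all add: mat_of_rows_list_def numeral_2_eq_2)
  then have "eigenvalue (mat2 (real_of_int a) c b d) u"
    using eigenvalues(1) by (auto simp: spectrum_def)
  then have "(a - u) * (d - u) - real_of_int c * b = 0"
    by (simp add: eigenvalue_mat2)
  moreover have det': "real_of_int a * d - real_of_int c * b = 1"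
    using arg_cong[OF det, of real_of_int] by simp
  ultimately have quad: "u * u + 1 = (a + d) * u"
    by (simp add: algebra_simps)
  then have "u \<noteq> 0" by auto
  with quad have tr: "u + 1 / u = a + d"
    by (simp add: field_simps)
  \<comment> \<open>A negative \<open>u\<close> would make the trace negative, and
    \<open>0 < u \<le> 1\<close> would give \<open>u \<le> 1 / u\<close>.\<close>
  have u: "1 < u"
  proof (rule ccontr)
    assume "\<not> 1 < u"
    moreover have "0 < u"
    proof (rule ccontr)
      assume "\<not> 0 < u"
      then have "u + 1 / u < 0" using \<open>u \<noteq> 0\<close> by (simp add: add_neg_neg)
      then show False using tr pos by simp
    qed
    ultimately have "u \<le> 1 / u" by (simp add: le_divide_eq mult_le_one)
    then show False using eigenvalues(2) by simp
  qed
  have u_inv: "1 / u < 1" using u by simp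
  have h: "0 < h" using eigenvalues(2) by (simp add: h_def)
  \<comment> \<open>Integrality enters here: \<open>a\<close> and \<open>d\<close> are at least 1,
    hence exceed \<open>1 / u\<close>.\<close>
  have \<alpha>: "0 < \<alpha>" and \<beta>: "0 < \<beta>"
    unfolding \<alpha>_def \<beta>_def using h u_inv pos by (auto intro!: divide_pos_pos)
  have v: "1 < u\<^sup>2" using u by simp
  note closed = mat2_pow_closed_form[of a c b d P C B D u, OF pow det u tr,
      folded h_def, folded \<alpha>_def \<beta>_def]
  have prod: "real_of_int (b * c) = \<alpha> * \<beta> * (u - 1 / u)\<^sup>2"
    using closed(1) by (simp add: h_def)

  have rec: "A ^\<^sub>m n = t \<cdot>\<^sub>m A ^\<^sub>m (n - 1) - A ^\<^sub>m (n - 2)" if "n \<ge> 2" for n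
    using mat2_pow_recurrence[OF det, of "n - 2"] that
    by (simp add: A_def trace_A Suc_diff_Suc numeral_2_eq_2)

  define S1 where "S1 = (\<lambda>k. rogers_dilog ((b / B (k + 2))\<^sup>2))"
  have S1: "S1 sums rogers_dilog (1 / u\<^sup>2)"
  proof -
    have "(b / B n)\<^sup>2 = (u\<^sup>2 - 1)\<^sup>2 * (u\<^sup>2) ^ n / (u\<^sup>2 * ((u\<^sup>2) ^ n - 1)\<^sup>2)" for n
    proof -
      have "(u\<^sup>2) ^ n = u ^ n * u ^ n"
        by (simp add: power2_eq_square power_mult_distrib)
      moreover from this have "u ^ n - 1 / u ^ n = ((u\<^sup>2) ^ n - 1) / u ^ n"
        using u by (simp add: diff_divide_distrib)
      moreover have "h = (u\<^sup>2 - 1) / u"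
        using u by (simp add: h_def diff_divide_distrib power2_eq_square)
      ultimately show ?thesis
        using pos u by (simp add: closed power_divide power_mult_distrib power2_eq_square mult_ac)
    qed
    then show ?thesis
      using rogers_dilog_powers_sums[OF v] by (simp add: S1_def)
  qed
  define S2 where "S2 = (\<lambda>k. rogers_dilog (real_of_int (b * c) / real_of_int (D (k + 2) * D k)))"
  have S2: "S2 sums (dilog_potential (u\<^sup>2) (\<alpha> / \<beta> * u\<^sup>2) - dilog_potential (u\<^sup>2) (\<beta> / \<alpha>)
      + rogers_dilog (1 - 1 / u\<^sup>2))"
    using bilinear_ratio_sums[OF u \<alpha> \<beta>]
    unfolding S2_def prod of_int_mult[of "D _"] closed .
  define S3 where "S3 = (\<lambda>k. rogers_dilog (real_of_int (b * c) / real_of_int (P (k + 2) * P k)))"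
  have S3: "S3 sums (dilog_potential (u\<^sup>2) (\<beta> / \<alpha> * u\<^sup>2) - dilog_potential (u\<^sup>2) (\<alpha> / \<beta>)
      + rogers_dilog (1 - 1 / u\<^sup>2))"
    using bilinear_ratio_sums[OF u \<beta> \<alpha>]
    unfolding S3_def prod of_int_mult[of "P _"] closed mult.commute[of \<alpha> \<beta>] .
  \<comment> \<open>This is the central term \<open>n = 0\<close> of the two-sided sequence, with
    \<open>w = 1\<close>: the neighbours of the centre are \<open>d\<close> and \<open>a\<close>.
    Its four potentials cancel the boundary potentials of \<open>S2\<close> and
    \<open>S3\<close>.\<close>
  have mid: "rogers_dilog (real_of_int (b * c) / real_of_int (a * d))
    = dilog_potential (u\<^sup>2) (\<alpha> / \<beta>) + dilog_potential (u\<^sup>2) (\<beta> / \<alpha>)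
      - dilog_potential (u\<^sup>2) (\<alpha> / \<beta> * u\<^sup>2) - dilog_potential (u\<^sup>2) (\<beta> / \<alpha> * u\<^sup>2)"
  proof -
    have "P 1 = a" "D 1 = d"
      using pow[of 1] mat2_carrier[of a c b d] by (simp_all add: mat2_eq_iff)
    then have "real_of_int (a * d) = (\<alpha> * (1 * u) + \<beta> / (1 * u)) * (\<alpha> * (1 / u) + \<beta> / (1 / u))"
      using closed(2,4)[of 1] by (simp add: mult_ac add_ac)
    then have "real_of_int (b * c) / real_of_int (a * d)
        = (u\<^sup>2 - 1)\<^sup>2 * (\<alpha> / \<beta>) / ((u\<^sup>2 * (\<alpha> / \<beta>) + 1) * (\<alpha> / \<beta> + u\<^sup>2))"
      using bilinear_ratio_eq[of u \<alpha> \<beta> 1] u \<alpha> \<beta> unfolding prod by simp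
    then show ?thesis
      using rogers_dilog_four_potentials[OF v, of "\<alpha> / \<beta>"] \<alpha> \<beta> by (simp add: mult_ac)
  qed
  have "rogers_dilog (1 / u\<^sup>2) + rogers_dilog (1 - 1 / u\<^sup>2) = pi\<^sup>2 / 6"
    by (rule rogers_dilog_reflection) (use v in \<open>auto simp: divide_le_eq\<close>)
  then have total: "2 * suminf S1 + suminf S2 + suminf S3
      + rogers_dilog (real_of_int (b * c) / real_of_int (a * d)) = pi\<^sup>2 / 3"
    unfolding mid sums_unique[OF S1, symmetric] sums_unique[OF S2, symmetric]
      sums_unique[OF S3, symmetric] by simp
  have index: "q (2 * (int k + 2) - 1) = B (k + 2)" "q (2 * (int k + 1)) = D (k + 2)"
    "q (2 * (int k + 1) - 4) = D k" "p (2 * (int k + 1) + 1) = P (k + 2)"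
    "p (2 * (int k + 1) - 3) = P k" for k
    by (simp_all add: B_def D_def P_def algebra_simps)
  show ?thesis
    unfolding Let_def index
    unfolding S1_def[symmetric] S2_def[symmetric] S3_def[symmetric]
    by (intro conjI allI impI rec S1 sums_summable[OF S2] sums_summable[OF S3] total)
qed

end
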